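(* Let $G$ be a (matrix) Lie group, i.e. a closed subgroup of $\mathrm{GL}_d(\mathbb{R})$. Then the exponential map $\exp$ defines a bijection between a neighbourhood of zero in the Lie algebra $\mathcal{L}(G)$ and a neighbourhood of the identity in $G$.
   Context: $\mathrm{M}_d(\mathbb{R})$ is the space of real $d\times d$ matrices with the Euclidean topology, and $\exp(A)=\sum_{n\ge 0} A^n/n!$. A (matrix) Lie group is a closed subgroup of $\mathrm{GL}_d(\mathbb{R})$. The Lie algebra of a Lie group $G\subset \mathrm{GL}_d(\mathbb{R})$ is $\mathcal{L}(G)=\{X\in \mathrm{M}_d(\mathbb{R}): \exp(tX)\in G \text{ for all } t\in\mathbb{R}\}$, which is a linear subspace of $\mathrm{M}_d(\mathbb{R})$. Neighbourhoods in $\mathcal{L}(G)$ and in $G$ are taken with respect to the topologies induced from $\mathrm{M}_d(\mathbb{R})$. *)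

theory Defs
  imports "HOL-Analysis.Analysis" "HOL-Algebra.Group"
begin

definition GL :: "(real^'d^'d) monoid" where
  "GL = \<lparr>carrier = {A. invertible A}, mult = (**), one = mat 1\<rparr>"

lemma group_GL: "group (GL :: (real^'d^'d) monoid)"
proof (rule groupI)
  fix A :: "real^'d^'d"
  assume "A \<in> carrier GL"
  then have "invertible A" by (simp add: GL_def)
  then obtain B where B: "A ** B = mat 1" "B ** A = mat 1"
    unfolding invertible_def by blast
  then have "invertible B" unfolding invertible_def by blast
  with B show "\<exists>B\<in>carrier GL. B \<otimes>\<^bsub>GL\<^esub> A = \<one>\<^bsub>GL\<^esub>"
    by (auto simp: GL_def)
next
  have "invertible (mat 1 :: real^'d^'d)"
    unfolding invertible_def by (intro exI[of _ "mat 1"]) simp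
  then show "\<one>\<^bsub>GL\<^esub> \<in> carrier (GL :: (real^'d^'d) monoid)" by (simp add: GL_def)
qed (auto simp: GL_def invertible_mult matrix_mul_assoc)

text \<open>Closedness is relative to the general linear group; a Lie group need not be closed in
  the space of all matrices.\<close>

definition matrix_Lie_group :: "(real^'d^'d) set \<Rightarrow> bool" where
  "matrix_Lie_group G \<longleftrightarrow>
     subgroup G GL \<and> closedin (top_of_set (carrier GL)) G"

text \<open>The type class operations \<open>*\<close>, \<open>1\<close> and \<open>^\<close> on \<open>real^'d^'d\<close> are
  componentwise, and \<open>exp\<close> is not available on this type, so matrix powers and the
  exponential series are defined from the matrix product.\<close>

primrec matrix_power :: "real^'d^'d \<Rightarrow> nat \<Rightarrow> real^'d^'d" where
  "matrix_power A 0 = mat 1"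
| "matrix_power A (Suc n) = A ** matrix_power A n"

definition matrix_exp :: "real^'d^'d \<Rightarrow> real^'d^'d" where
  "matrix_exp A = (\<Sum>n. matrix_power A n /\<^sub>R fact n)"

definition Lie_algebra :: "(real^'d^'d) set \<Rightarrow> (real^'d^'d) set" where
  "Lie_algebra G = {X. \<forall>t::real. matrix_exp (t *\<^sub>R X) \<in> G}"

end

theory Submission
  imports Defs
begin

text \<open>
  Near \<open>0\<close> the exponential series is a small perturbation of \<open>X \<mapsto> 1 + X\<close>: the map
  \<open>X \<mapsto> exp X - X\<close> has Lipschitz constant \<open>exp M - 1\<close> on the ball of radius \<open>M\<close>
  (\<open>norm_matrix_exp_diff_le\<close>). Hence \<open>exp\<close> is injective on a small ball, and by invariance of
  domain it maps smaller balls onto open sets of matrices. Restricting to such a ball and to the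
  Lie algebra gives a bijection onto a neighbourhood of the identity in \<open>G\<close> as soon as every
  sufficiently small \<open>X\<close> with \<open>exp X \<in> G\<close> lies in the Lie algebra
  (\<open>small_logarithm_in_Lie_algebra\<close>).

  The source of elements of the Lie algebra is \<open>tangent_vector_in_Lie_algebra\<close>: if \<open>h\<^sub>n \<in> G\<close> and
  \<open>(h\<^sub>n - 1) / \<epsilon>\<^sub>n \<rightarrow> Y\<close> for positive \<open>\<epsilon>\<^sub>n \<rightarrow> 0\<close>, then \<open>Y\<close> is in the Lie algebra. The powers
  of \<open>h\<^sub>n\<close> with exponent about \<open>t / \<epsilon>\<^sub>n\<close> converge to \<open>exp (t Y)\<close>, and \<open>G\<close> is closed. Applied to
  \<open>exp (\<epsilon> X) exp (\<epsilon> Y)\<close>, it shows that the Lie algebra is closed under addition.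

  Now suppose that \<open>X\<^sub>n \<rightarrow> 0\<close>, that \<open>exp X\<^sub>n \<in> G\<close>, and that no \<open>X\<^sub>n\<close> is in the Lie algebra.
  Let \<open>Z\<^sub>n\<close> be the orthogonal projection of \<open>X\<^sub>n\<close> to the Lie algebra and \<open>W\<^sub>n = X\<^sub>n - Z\<^sub>n\<close>.
  Then \<open>exp (- Z\<^sub>n) exp X\<^sub>n \<in> G\<close> equals \<open>1 + W\<^sub>n\<close> up to an error of smaller order than
  \<open>W\<^sub>n\<close>, so a limit point of \<open>W\<^sub>n / |W\<^sub>n|\<close> is a unit vector in the Lie algebra that is
  orthogonal to the Lie algebra, which is impossible.
\<close>

section \<open>The Frobenius norm and matrix powers\<close>

text \<open>The norm of the type \<open>real^'n^'m\<close> is the Frobenius norm; row by row, this is the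
  Cauchy-Schwarz inequality.\<close>

lemma norm_matrix_mult_le:
  fixes A :: "real^'n^'m" and B :: "real^'p^'n"
  shows "norm (A ** B) \<le> norm A * norm B"
proof -
  have row: "norm ((A ** B) $ i) \<le> norm (A $ i) * norm B" for i
  proof -
    have "(A ** B) $ i = (\<Sum>k\<in>UNIV. (A $ i $ k) *\<^sub>R (B $ k))"
      by (simp add: vec_eq_iff matrix_matrix_mult_def)
    then have "norm ((A ** B) $ i) \<le> (\<Sum>k\<in>UNIV. \<bar>A $ i $ k\<bar> * \<bar>norm (B $ k)\<bar>)"
      by (simp add: sum_norm_le)
    also have "\<dots> \<le> L2_set (\<lambda>k. A $ i $ k) UNIV * L2_set (\<lambda>k. norm (B $ k)) UNIV"
      by (rule L2_set_mult_ineq)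
    finally show ?thesis by (simp add: norm_vec_def L2_set_def)
  qed
  have "norm (A ** B) \<le> L2_set (\<lambda>i. norm (A $ i) * norm B) UNIV"
    unfolding norm_vec_def[of "A ** B"] by (intro L2_set_mono row) auto
  also have "\<dots> = norm A * norm B"
    by (simp add: norm_vec_def[of A] L2_set_left_distrib)
  finally show ?thesis .
qed

interpretation matrix_mult: bounded_bilinear "(**) :: real^'n^'m \<Rightarrow> real^'p^'n \<Rightarrow> real^'p^'m"
proof
  show "\<exists>K. \<forall>A B. norm ((A :: real^'n^'m) ** (B :: real^'p^'n)) \<le> norm A * norm B * K"
    using norm_matrix_mult_le by (intro exI[of _ 1]) auto
qed (auto simp: matrix_matrix_mult_def vec_eq_iff algebra_simps sum.distrib sum_distrib_left)

text \<open>The factor \<open>C\<close> is there because the identity has Frobenius norm \<open>sqrt d\<close>: a bound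
  \<open>norm B ^ n\<close> on the power alone fails for \<open>n = 0\<close> and \<open>d > 1\<close>.\<close>

lemma norm_mult_matrix_power_le:
  "norm (C ** matrix_power B n) \<le> norm C * norm B ^ n"
proof (induction n arbitrary: C)
  case (Suc n)
  have "norm ((C ** B) ** matrix_power B n) \<le> norm (C ** B) * norm B ^ n"
    by (rule Suc)
  also have "\<dots> \<le> (norm C * norm B) * norm B ^ n"
    by (intro mult_right_mono norm_matrix_mult_le) auto
  finally show ?case by (simp add: matrix_mul_assoc mult.assoc)
qed simp

text \<open>Telescoping \<open>A\<^bsup>n+1\<^esup> - B\<^bsup>n+1\<^esup> = A (A\<^bsup>n\<^esup> - B\<^bsup>n\<^esup>) + (A - B) B\<^bsup>n\<^esup>\<close> replaces the power rule, as
  \<open>A\<close> and \<open>B\<close> need not commute.\<close>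

lemma norm_matrix_power_diff_le:
  fixes M :: real
  assumes "norm A \<le> M" "norm B \<le> M"
  shows "norm (matrix_power A (Suc n) - matrix_power B (Suc n)) \<le> Suc n * M ^ n * norm (A - B)"
proof (induction n)
  case (Suc n)
  let ?P = "matrix_power A (Suc n)" and ?Q = "matrix_power B (Suc n)"
  have M: "0 \<le> M" using assms(1) norm_ge_zero order_trans by blast
  have "matrix_power A (Suc (Suc n)) - matrix_power B (Suc (Suc n))
      = A ** (?P - ?Q) + (A - B) ** ?Q"
    by (simp add: matrix_mult.diff_left matrix_mult.diff_right)
  also have "norm \<dots> \<le> norm A * norm (?P - ?Q) + norm (A - B) * norm B ^ Suc n"
    by (intro norm_triangle_le add_mono norm_matrix_mult_le norm_mult_matrix_power_le)
  also have "\<dots> \<le> M * (Suc n * M ^ n * norm (A - B)) + norm (A - B) * M ^ Suc n"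
    using assms M by (intro add_mono mult_mono Suc power_mono) auto
  finally show ?case by (simp add: algebra_simps)
qed simp

lemma matrix_power_scaleR: "matrix_power (c *\<^sub>R A) n = c ^ n *\<^sub>R matrix_power A n"
  by (induction n) (simp_all add: matrix_mult.scaleR_left matrix_mult.scaleR_right)

lemma matrix_power_add: "matrix_power A (m + n) = matrix_power A m ** matrix_power A n"
  by (induction m) (simp_all add: matrix_mul_assoc)

section \<open>The exponential series\<close>

lemma summable_norm_matrix_exp:
  fixes A :: "real^'d^'d"
  shows "summable (\<lambda>n. norm (matrix_power A n /\<^sub>R fact n))"
proof (rule summable_comparison_test')
  show "summable (\<lambda>n. norm (mat 1 :: real^'d^'d) * (norm A ^ n /\<^sub>R fact n))"
    using summable_exp_generic[of "norm A"] by (intro summable_mult)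
  show "norm (norm (matrix_power A n /\<^sub>R fact n)) \<le> norm (mat 1 :: real^'d^'d) * (norm A ^ n /\<^sub>R fact n)"
    if "0 \<le> n" for n
    using norm_mult_matrix_power_le[of "mat 1" A n] by (simp add: field_simps)
qed

lemma matrix_exp_sums: "(\<lambda>n. matrix_power A n /\<^sub>R fact n) sums matrix_exp A"
  unfolding matrix_exp_def
  by (rule summable_sums[OF summable_norm_cancel[OF summable_norm_matrix_exp]])

lemma matrix_exp_0 [simp]: "matrix_exp (0 :: real^'d^'d) = mat 1"
proof -
  have "matrix_power (0 :: real^'d^'d) n /\<^sub>R fact n = 0" if n: "n \<notin> {0}" for n
  proof -
    obtain m where "n = Suc m" using n by (cases n) auto
    then show ?thesis by (simp only: matrix_power.simps matrix_mult.zero_left scaleR_zero_right)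
  qed
  then have "(\<lambda>n. matrix_power (0 :: real^'d^'d) n /\<^sub>R fact n) sums (\<Sum>n\<in>{0}. matrix_power (0 :: real^'d^'d) n /\<^sub>R fact n)"
    by (intro sums_finite) blast+
  then show ?thesis unfolding matrix_exp_def by (simp add: sums_iff)
qed

text \<open>Strict differentiability of \<open>exp\<close> at \<open>0\<close>, with an explicit constant. The terms of
  order \<open>0\<close> and \<open>1\<close> of the series cancel, and the others are bounded by the series of
  \<open>exp M - 1\<close> through \<open>norm_matrix_power_diff_le\<close>.\<close>

lemma norm_matrix_exp_diff_le:
  assumes "norm X \<le> M" "norm Z \<le> M"
  shows "norm (matrix_exp X - matrix_exp Z - (X - Z)) \<le> (exp M - 1) * norm (X - Z)"
proof -
  define D where "D = (\<lambda>n. matrix_power X n /\<^sub>R fact n - matrix_power Z n /\<^sub>R fact n)"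
  have D: "D sums (matrix_exp X - matrix_exp Z)"
    unfolding D_def by (intro sums_diff matrix_exp_sums)
  have "(\<Sum>n<2. D n) = X - Z"
    by (simp add: D_def numeral_2_eq_2)
  then have tail: "(\<lambda>n. D (n + 2)) sums (matrix_exp X - matrix_exp Z - (X - Z))"
    using sums_split_initial_segment[OF D, of 2] by simp
  have "(\<lambda>n. M ^ (n + 1) /\<^sub>R fact (n + 1)) sums (exp M - (\<Sum>n<1. M ^ n /\<^sub>R fact n))"
    by (rule sums_split_initial_segment[OF exp_converges])
  then have "(\<lambda>n. M ^ (n + 1) / fact (n + 1)) sums (exp M - 1)"
    by (simp add: divide_inverse mult.commute del: fact_Suc power_Suc)
  then have bound: "(\<lambda>n. M ^ (n + 1) / fact (n + 1) * norm (X - Z)) sums ((exp M - 1) * norm (X - Z))"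
    by (rule sums_mult2)
  have le: "norm (D (n + 2)) \<le> M ^ (n + 1) / fact (n + 1) * norm (X - Z)" for n
  proof -
    have "D (n + 2) = (matrix_power X (Suc (n + 1)) - matrix_power Z (Suc (n + 1))) /\<^sub>R fact (n + 2)"
      by (simp only: D_def scaleR_diff_right) simp
    then have "norm (D (n + 2))
        = norm (matrix_power X (Suc (n + 1)) - matrix_power Z (Suc (n + 1))) / fact (n + 2)"
      by (simp only: norm_scaleR) (simp add: divide_inverse del: matrix_power.simps fact_Suc)
    also have "\<dots> \<le> (Suc (n + 1) * M ^ (n + 1) * norm (X - Z)) / fact (n + 2)"
      by (intro divide_right_mono norm_matrix_power_diff_le assms) simp
    also have "\<dots> = M ^ (n + 1) / fact (n + 1) * norm (X - Z)"
    proof -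
      have eq: "(fact (n + 2) :: real) = real (Suc (n + 1)) * fact (n + 1)"
        by (simp add: algebra_simps)
      show ?thesis
        unfolding eq mult.assoc by (subst mult_divide_mult_cancel_left) (simp_all del: fact_Suc)
    qed
    finally show ?thesis .
  qed
  show ?thesis
    using norm_suminf_le[OF le sums_summable[OF bound]]
    unfolding sums_unique[OF tail, symmetric] sums_unique[OF bound, symmetric] .
qed

text \<open>Each entry of the product is a finite sum of products of absolutely convergent real series,
  so the Cauchy product of real series applies, and the binomial theorem sums its terms.\<close>

lemma matrix_exp_add_scaleR:
  fixes A :: "real^'d^'d"
  shows "matrix_exp ((s + t) *\<^sub>R A) = matrix_exp (s *\<^sub>R A) ** matrix_exp (t *\<^sub>R A)"
proof -
  define a where "a u n = matrix_power (u *\<^sub>R A) n /\<^sub>R fact n" for u n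
  have conv: "(\<Sum>k\<le>n. a s k ** a t (n - k)) = a (s + t) n" for n
  proof -
    have "a s k ** a t (n - k)
        = ((n choose k) * s ^ k * t ^ (n - k) / fact n) *\<^sub>R matrix_power A n" if "k \<le> n" for k
    proof -
      have "matrix_power A k ** matrix_power A (n - k) = matrix_power A n"
        using that by (simp flip: matrix_power_add)
      then show ?thesis
        using that by (simp add: a_def matrix_power_scaleR matrix_mult.scaleR_left
            matrix_mult.scaleR_right binomial_fact divide_simps mult_ac)
    qed
    then have "(\<Sum>k\<le>n. a s k ** a t (n - k))
        = ((\<Sum>k\<le>n. (n choose k) * s ^ k * t ^ (n - k)) / fact n) *\<^sub>R matrix_power A n"
      by (simp add: scaleR_left.sum sum_divide_distrib)
    also have "(\<Sum>k\<le>n. (n choose k) * s ^ k * t ^ (n - k)) = (s + t) ^ n"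
      by (simp add: binomial_ring)
    also have "((s + t) ^ n / fact n) *\<^sub>R matrix_power A n = a (s + t) n"
      by (simp add: a_def matrix_power_scaleR divide_inverse mult.commute)
    finally show ?thesis .
  qed
  have entry: "(\<lambda>n. a u n $ i $ j) sums (matrix_exp (u *\<^sub>R A) $ i $ j)" for u i j
    using matrix_exp_sums[of "u *\<^sub>R A"] unfolding a_def
    by (intro bounded_linear.sums[OF bounded_linear_vec_nth]) auto
  have entry_norm: "summable (\<lambda>n. norm (a u n $ i $ j))" for u i j
  proof (rule summable_comparison_test')
    show "summable (\<lambda>n. norm (a u n))" unfolding a_def by (rule summable_norm_matrix_exp)
    show "norm (norm (a u n $ i $ j)) \<le> norm (a u n)" if "0 \<le> n" for n
      using order_trans[OF Finite_Cartesian_Product.norm_nth_le Finite_Cartesian_Product.norm_nth_le, of "a u n" i j] by simp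
  qed
  have "matrix_exp ((s + t) *\<^sub>R A) $ i $ j = (matrix_exp (s *\<^sub>R A) ** matrix_exp (t *\<^sub>R A)) $ i $ j" for i j
  proof -
    have "(\<lambda>n. \<Sum>k\<le>n. a s k $ i $ l * a t (n - k) $ l $ j)
        sums (matrix_exp (s *\<^sub>R A) $ i $ l * matrix_exp (t *\<^sub>R A) $ l $ j)" for l
      using Cauchy_product_sums[OF entry_norm entry_norm, of s i l t l j]
      by (simp add: sums_unique[OF entry, symmetric])
    then have "(\<lambda>n. \<Sum>l\<in>UNIV. \<Sum>k\<le>n. a s k $ i $ l * a t (n - k) $ l $ j)
        sums (\<Sum>l\<in>UNIV. matrix_exp (s *\<^sub>R A) $ i $ l * matrix_exp (t *\<^sub>R A) $ l $ j)"
      by (intro sums_sum)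
    moreover have "(\<Sum>l\<in>UNIV. \<Sum>k\<le>n. a s k $ i $ l * a t (n - k) $ l $ j) = a (s + t) n $ i $ j" for n
      by (subst sum.swap) (simp add: matrix_matrix_mult_def flip: conv)
    ultimately show ?thesis
      using entry[of "s + t" i j] sums_unique2 by (fastforce simp: matrix_matrix_mult_def)
  qed
  then show ?thesis by (simp add: vec_eq_iff)
qed

lemma matrix_exp_minus:
  "matrix_exp X ** matrix_exp (- X) = mat 1" "matrix_exp (- X) ** matrix_exp X = mat 1"
  using matrix_exp_add_scaleR[of 1 "-1" X] matrix_exp_add_scaleR[of "-1" 1 X] by simp_all

lemma invertible_matrix_exp: "invertible (matrix_exp X)"
  unfolding invertible_def using matrix_exp_minus by blast

lemma matrix_exp_of_nat_scaleR: "matrix_exp (real n *\<^sub>R X) = matrix_power (matrix_exp X) n"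
proof (induction n)
  case (Suc n)
  then show ?case using matrix_exp_add_scaleR[of 1 "real n" X] by (simp add: add.commute)
qed simp

lemma continuous_on_matrix_exp: "continuous_on S matrix_exp"
proof -
  have "isCont matrix_exp Z" for Z :: "real^'a^'a"
  proof -
    define M where "M = norm Z + 1"
    have "\<forall>\<^sub>F X in at Z. norm (matrix_exp X - matrix_exp Z) \<le> exp M * norm (X - Z)"
      unfolding eventually_at
    proof (intro exI[of _ 1] conjI ballI impI)
      fix X assume "X \<noteq> Z \<and> dist X Z < 1"
      then have "norm X \<le> M" "norm Z \<le> M"
        using norm_triangle_sub[of X Z] by (auto simp: M_def dist_norm)
      from norm_matrix_exp_diff_le[OF this]
      show "norm (matrix_exp X - matrix_exp Z) \<le> exp M * norm (X - Z)"
        using norm_triangle_sub[of "matrix_exp X - matrix_exp Z" "X - Z"] by (simp add: algebra_simps)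
    qed simp
    moreover have "((\<lambda>X. exp M * norm (X - Z)) \<longlongrightarrow> 0) (at Z)"
      by (auto intro!: tendsto_eq_intros)
    ultimately have "((\<lambda>X. matrix_exp X - matrix_exp Z) \<longlongrightarrow> 0) (at Z)"
      by (rule Lim_null_comparison)
    then show ?thesis unfolding isCont_def by (simp add: LIM_zero_iff)
  qed
  then show ?thesis by (simp add: continuous_at_imp_continuous_on)
qed

lemma tendsto_matrix_exp:
  "(f \<longlongrightarrow> X) F \<Longrightarrow> ((\<lambda>n. matrix_exp (f n)) \<longlongrightarrow> matrix_exp X) F"
  using continuous_on_tendsto_compose[OF continuous_on_matrix_exp[of UNIV]] by auto

section \<open>The exponential as a chart at the identity\<close>

text \<open>The radius at which the Lipschitz constant \<open>exp M - 1\<close> of \<open>X \<mapsto> exp X - X\<close>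
  reaches \<open>1/2\<close>.\<close>

definition chart_radius :: real where "chart_radius = ln (3/2)"

lemma chart_radius_pos: "0 < chart_radius" by (simp add: chart_radius_def)

lemma matrix_exp_expands:
  assumes "norm X \<le> chart_radius" "norm Z \<le> chart_radius"
  shows "norm (X - Z) \<le> 2 * norm (matrix_exp X - matrix_exp Z)"
proof -
  have "norm (matrix_exp X - matrix_exp Z - (X - Z)) \<le> 1/2 * norm (X - Z)"
    using norm_matrix_exp_diff_le[OF assms] by (simp add: chart_radius_def)
  then show ?thesis
    using norm_triangle_sub[of "X - Z" "matrix_exp X - matrix_exp Z"] by (simp add: norm_minus_commute)
qed

lemma inj_on_matrix_exp: "inj_on matrix_exp (ball (0 :: real^'d^'d) chart_radius)"
proof (rule inj_onI)
  fix X Z :: "real^'d^'d"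
  assume "X \<in> ball 0 chart_radius" "Z \<in> ball 0 chart_radius" "matrix_exp X = matrix_exp Z"
  then show "X = Z" using matrix_exp_expands[of X Z] by simp
qed

text \<open>Invariance of domain turns injectivity and continuity into openness, which takes the place
  of constructing a logarithm.\<close>

lemma open_matrix_exp_image:
  assumes "r \<le> chart_radius"
  shows "open (matrix_exp ` ball (0 :: real^'d^'d) r)"
  using assms
  by (intro invariance_of_domain continuous_on_matrix_exp inj_on_subset[OF inj_on_matrix_exp]) auto

text \<open>Near \<open>0\<close>, differences of exponentials may be replaced by differences of exponents, even
  after division by \<open>\<epsilon> n\<close>: the error is the quotient itself times a null sequence.\<close>

lemma tendsto_matrix_exp_diff_quotient:
  fixes X Z :: "nat \<Rightarrow> real^'d^'d"
  assumes X: "X \<longlonglongrightarrow> 0" and Z: "Z \<longlonglongrightarrow> 0"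
    and lim: "(\<lambda>n. (X n - Z n) /\<^sub>R \<epsilon> n) \<longlonglongrightarrow> Y"
  shows "(\<lambda>n. (matrix_exp (X n) - matrix_exp (Z n)) /\<^sub>R \<epsilon> n) \<longlonglongrightarrow> Y"
proof -
  define M where "M n = max (norm (X n)) (norm (Z n))" for n
  have "M \<longlonglongrightarrow> max (norm (0 :: real^'d^'d)) (norm (0 :: real^'d^'d))"
    unfolding M_def by (intro tendsto_max tendsto_norm X Z)
  then have "(\<lambda>n. (exp (M n) - 1) * norm ((X n - Z n) /\<^sub>R \<epsilon> n)) \<longlonglongrightarrow> (exp 0 - 1) * norm Y"
    by (intro tendsto_intros lim) simp
  then have lim0: "(\<lambda>n. (exp (M n) - 1) * norm ((X n - Z n) /\<^sub>R \<epsilon> n)) \<longlonglongrightarrow> 0" by simp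
  have "norm ((matrix_exp (X n) - matrix_exp (Z n)) /\<^sub>R \<epsilon> n - (X n - Z n) /\<^sub>R \<epsilon> n)
      \<le> (exp (M n) - 1) * norm ((X n - Z n) /\<^sub>R \<epsilon> n)" for n
  proof -
    have "norm (matrix_exp (X n) - matrix_exp (Z n) - (X n - Z n)) * \<bar>inverse (\<epsilon> n)\<bar>
        \<le> (exp (M n) - 1) * norm (X n - Z n) * \<bar>inverse (\<epsilon> n)\<bar>"
      by (intro mult_right_mono norm_matrix_exp_diff_le) (auto simp: M_def)
    then show ?thesis by (simp flip: scaleR_diff_right add: mult_ac)
  qed
  then have "(\<lambda>n. (matrix_exp (X n) - matrix_exp (Z n)) /\<^sub>R \<epsilon> n - (X n - Z n) /\<^sub>R \<epsilon> n) \<longlonglongrightarrow> 0"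
    by (intro Lim_null_comparison[OF _ lim0]) simp
  from tendsto_add[OF this lim] show ?thesis by simp
qed

section \<open>Tangent vectors of a matrix group\<close>

context
  fixes G :: "(real^'d^'d) set"
  assumes G: "matrix_Lie_group G"
begin

lemma Lie_group_one: "mat 1 \<in> G"
  and Lie_group_mult: "A \<in> G \<Longrightarrow> B \<in> G \<Longrightarrow> A ** B \<in> G"
  using G subgroup.one_closed[of G GL] subgroup.m_closed[of G GL]
  by (auto simp: matrix_Lie_group_def GL_def)

lemma Lie_group_matrix_power: "A \<in> G \<Longrightarrow> matrix_power A n \<in> G"
  by (induction n) (auto intro: Lie_group_one Lie_group_mult)

lemma Lie_group_left_inverse:
  assumes "A \<in> G" "B ** A = mat 1"
  shows "B \<in> G"
proof -
  have sub: "subgroup G GL" using G by (simp add: matrix_Lie_group_def)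
  then have AG: "A \<in> carrier GL" using assms(1) subgroup.subset by blast
  have "B \<in> carrier GL" using assms(2) by (auto simp: GL_def invertible_def matrix_left_right_inverse)
  then have "inv\<^bsub>GL\<^esub> A = B"
    using group.inv_equality[OF group_GL, of B A] AG assms(2) by (simp add: GL_def)
  then show ?thesis using subgroup.m_inv_closed[OF sub assms(1)] by simp
qed

text \<open>\<open>G\<close> is closed only among the invertible matrices, so the limit has to be invertible. All
  limits to which this is applied are exponentials.\<close>

lemma Lie_group_limit:
  assumes "\<And>n. h n \<in> G" "h \<longlonglongrightarrow> B" "invertible B"
  shows "B \<in> G"
proof -
  obtain C where C: "closed C" "G = C \<inter> carrier GL"
    using G by (auto simp: matrix_Lie_group_def closedin_closed)
  then have "B \<in> C" using assms closed_sequentially[of C h B] by auto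
  then show ?thesis using C assms(3) by (simp add: GL_def)
qed

lemma matrix_exp_Lie_algebra: "X \<in> Lie_algebra G \<Longrightarrow> matrix_exp X \<in> G"
  unfolding Lie_algebra_def by (metis (mono_tags) mem_Collect_eq scaleR_one)

lemma Lie_algebra_scaleR: "X \<in> Lie_algebra G \<Longrightarrow> c *\<^sub>R X \<in> Lie_algebra G"
  unfolding Lie_algebra_def by simp

text \<open>For large \<open>n\<close> the element \<open>h n\<close> is \<open>exp (X n)\<close> with \<open>X n\<close> small, and \<open>X n / \<epsilon> n\<close> also
  tends to \<open>Y\<close>. With \<open>k n = \<lfloor>t / \<epsilon> n\<rfloor>\<close> the powers \<open>(h n)\<^bsup>k n\<^esup> = exp (k n X n)\<close> stay in \<open>G\<close> and
  converge to \<open>exp (t Y)\<close>. Since \<open>k n\<close> is a natural number, this covers \<open>t \<ge> 0\<close>; inverses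
  give the rest.\<close>

lemma tangent_vector_in_Lie_algebra:
  assumes hG: "\<And>n. h n \<in> G" and pos: "\<And>n. 0 < \<epsilon> n" and eps: "\<epsilon> \<longlonglongrightarrow> 0"
    and lim: "(\<lambda>n. (h n - mat 1) /\<^sub>R \<epsilon> n) \<longlonglongrightarrow> Y"
  shows "Y \<in> Lie_algebra G"
proof -
  have "(\<lambda>n. \<epsilon> n *\<^sub>R ((h n - mat 1) /\<^sub>R \<epsilon> n)) \<longlonglongrightarrow> 0 *\<^sub>R Y"
    by (intro tendsto_intros eps lim)
  moreover have "\<epsilon> n *\<^sub>R ((h n - mat 1) /\<^sub>R \<epsilon> n) = h n - mat 1" for n
    using pos[of n] by simp
  ultimately have h1: "(\<lambda>n. h n - mat 1) \<longlonglongrightarrow> 0" by simp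
  then have "h \<longlonglongrightarrow> mat 1" by (simp add: LIM_zero_iff)
  moreover have "mat 1 \<in> matrix_exp ` ball (0 :: real^'d^'d) chart_radius"
    using chart_radius_pos by (intro image_eqI[of _ _ 0]) auto
  ultimately have "\<forall>\<^sub>F n in sequentially. h n \<in> matrix_exp ` ball 0 chart_radius"
    using topological_tendstoD[OF _ open_matrix_exp_image[OF order_refl]] by blast
  then obtain N where N: "\<And>n. N \<le> n \<Longrightarrow> h n \<in> matrix_exp ` ball 0 chart_radius"
    by (auto simp: eventually_sequentially)
  then have "\<forall>n. \<exists>X. norm X < chart_radius \<and> h (n + N) = matrix_exp X"
    by (metis (no_types, lifting) imageE le_add2 mem_ball_0)
  then obtain X where X: "\<And>n. norm (X n) < chart_radius" "\<And>n. h (n + N) = matrix_exp (X n)"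
    by metis
  \<comment> \<open>Indices are shifted by \<open>N\<close> so that the logarithms \<open>X n\<close> of the group elements exist
    for all \<open>n\<close>.\<close>
  define \<delta> where "\<delta> n = \<epsilon> (n + N)" for n
  have \<delta>: "\<And>n. 0 < \<delta> n" "\<delta> \<longlonglongrightarrow> 0"
    unfolding \<delta>_def using pos LIMSEQ_ignore_initial_segment[OF eps] by auto
  have limX: "(\<lambda>n. (matrix_exp (X n) - mat 1) /\<^sub>R \<delta> n) \<longlonglongrightarrow> Y"
    using LIMSEQ_ignore_initial_segment[OF lim, of N] by (simp add: X \<delta>_def)
  have exp1: "(\<lambda>n. matrix_exp (X n) - mat 1) \<longlonglongrightarrow> 0"
    using LIMSEQ_ignore_initial_segment[OF h1, of N] by (simp add: X)
  have bound: "norm (X n) \<le> 2 * norm (matrix_exp (X n) - mat 1)" for n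
    using matrix_exp_expands[of "X n" 0] X(1)[of n] chart_radius_pos by simp
  have X0: "X \<longlonglongrightarrow> 0"
  proof (rule Lim_null_comparison)
    show "(\<lambda>n. 2 * norm (matrix_exp (X n) - mat 1)) \<longlonglongrightarrow> 0"
      using tendsto_mult_right_zero[OF tendsto_norm_zero[OF exp1]] by simp
  qed (simp add: bound)
  have quot: "(\<lambda>n. X n /\<^sub>R \<delta> n) \<longlonglongrightarrow> Y"
  proof -
    let ?q = "\<lambda>n. (matrix_exp (X n) - mat 1) /\<^sub>R \<delta> n"
    have "(\<lambda>n. (exp (norm (X n)) - 1) * (2 * norm (?q n))) \<longlonglongrightarrow> (exp (norm (0 :: real^'d^'d)) - 1) * (2 * norm Y)"
      by (intro tendsto_intros X0 limX)
    then have lim0: "(\<lambda>n. (exp (norm (X n)) - 1) * (2 * norm (?q n))) \<longlonglongrightarrow> 0" by simp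
    \<comment> \<open>The quotient \<open>X n / \<delta> n\<close> is not yet known to be bounded; the expansion bound
      estimates it by the convergent \<open>?q\<close>.\<close>
    have "norm (?q n - X n /\<^sub>R \<delta> n) \<le> (exp (norm (X n)) - 1) * (2 * norm (?q n))" for n
    proof -
      have "norm (matrix_exp (X n) - mat 1 - X n) \<le> (exp (norm (X n)) - 1) * norm (X n)"
        using norm_matrix_exp_diff_le[of "X n" "norm (X n)" 0] by simp
      also have "\<dots> \<le> (exp (norm (X n)) - 1) * (2 * norm (matrix_exp (X n) - mat 1))"
        by (intro mult_left_mono bound) simp
      finally have "norm (matrix_exp (X n) - mat 1 - X n) * inverse (\<delta> n)
          \<le> (exp (norm (X n)) - 1) * (2 * norm (matrix_exp (X n) - mat 1)) * inverse (\<delta> n)"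
        using \<delta>(1)[of n] by (intro mult_right_mono) auto
      then show ?thesis
        using \<delta>(1)[of n] by (simp flip: scaleR_diff_right add: mult_ac)
    qed
    then have "(\<lambda>n. ?q n - X n /\<^sub>R \<delta> n) \<longlonglongrightarrow> 0"
      by (intro Lim_null_comparison[OF _ lim0]) simp
    from tendsto_diff[OF limX this] show ?thesis by simp
  qed
  have nonneg: "matrix_exp (t *\<^sub>R Y) \<in> G" if t: "0 \<le> t" for t
  proof -
    define k where "k n = nat \<lfloor>t / \<delta> n\<rfloor>" for n
    have k: "\<bar>real (k n) * \<delta> n - t\<bar> \<le> \<delta> n" for n
    proof -
      have "real (k n) \<le> t / \<delta> n" "t / \<delta> n < real (k n) + 1"
        using t \<delta>(1)[of n] by (auto simp: k_def)
      then show ?thesis using \<delta>(1)[of n] by (auto simp: field_simps abs_le_iff)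
    qed
    have "(\<lambda>n. real (k n) * \<delta> n - t) \<longlonglongrightarrow> 0"
      using k by (intro Lim_null_comparison[OF _ \<delta>(2)]) simp
    then have "(\<lambda>n. real (k n) * \<delta> n) \<longlonglongrightarrow> t" by (simp add: LIM_zero_iff)
    then have "(\<lambda>n. (real (k n) * \<delta> n) *\<^sub>R (X n /\<^sub>R \<delta> n)) \<longlonglongrightarrow> t *\<^sub>R Y"
      by (intro tendsto_scaleR quot)
    moreover have "(real (k n) * \<delta> n) *\<^sub>R (X n /\<^sub>R \<delta> n) = real (k n) *\<^sub>R X n" for n
      using \<delta>(1)[of n] by simp
    ultimately have "(\<lambda>n. real (k n) *\<^sub>R X n) \<longlonglongrightarrow> t *\<^sub>R Y"
      by (simp only:)
    then have "(\<lambda>n. matrix_exp (real (k n) *\<^sub>R X n)) \<longlonglongrightarrow> matrix_exp (t *\<^sub>R Y)"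
      by (rule tendsto_matrix_exp)
    moreover have "matrix_exp (real (k n) *\<^sub>R X n) \<in> G" for n
      using Lie_group_matrix_power[OF hG[of "n + N"]] by (simp add: matrix_exp_of_nat_scaleR X)
    ultimately show ?thesis by (intro Lie_group_limit[OF _ _ invertible_matrix_exp])
  qed
  have "matrix_exp (t *\<^sub>R Y) \<in> G" for t
  proof (cases "0 \<le> t")
    case False
    then have "matrix_exp (- (t *\<^sub>R Y)) \<in> G" using nonneg[of "- t"] by simp
    then show ?thesis by (rule Lie_group_left_inverse) (rule matrix_exp_minus)
  qed (rule nonneg)
  then show ?thesis by (simp add: Lie_algebra_def)
qed

text \<open>For sums: \<open>exp (\<epsilon> X) exp (\<epsilon> Y)\<close> is a curve in \<open>G\<close> through \<open>1\<close> with tangent vector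
  \<open>X + Y\<close>.\<close>

lemma subspace_Lie_algebra: "subspace (Lie_algebra G)"
proof (rule subspaceI)
  show "0 \<in> Lie_algebra G" by (simp add: Lie_algebra_def Lie_group_one)
  show "c *\<^sub>R X \<in> Lie_algebra G" if "X \<in> Lie_algebra G" for c X
    using that by (rule Lie_algebra_scaleR)
  show "X + Y \<in> Lie_algebra G" if XY: "X \<in> Lie_algebra G" "Y \<in> Lie_algebra G" for X Y
  proof -
    define \<epsilon> where "\<epsilon> n = inverse (real (Suc n))" for n
    have \<epsilon>: "\<And>n. 0 < \<epsilon> n" "\<epsilon> \<longlonglongrightarrow> 0"
      unfolding \<epsilon>_def using LIMSEQ_inverse_real_of_nat by simp_all
    define h where "h n = matrix_exp (\<epsilon> n *\<^sub>R X) ** matrix_exp (\<epsilon> n *\<^sub>R Y)" for n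
    have null: "(\<lambda>n. \<epsilon> n *\<^sub>R Z) \<longlonglongrightarrow> 0" for Z :: "real^'d^'d"
      using tendsto_scaleR[OF \<epsilon>(2) tendsto_const[of Z]] by simp
    have deriv: "(\<lambda>n. (matrix_exp (\<epsilon> n *\<^sub>R Z) - mat 1) /\<^sub>R \<epsilon> n) \<longlonglongrightarrow> Z" for Z :: "real^'d^'d"
      using tendsto_matrix_exp_diff_quotient[OF null[of Z] tendsto_const[of 0], of \<epsilon> Z] \<epsilon>(1)
      by (simp add: less_imp_neq[symmetric])
    have "(\<lambda>n. matrix_exp (\<epsilon> n *\<^sub>R X) ** ((matrix_exp (\<epsilon> n *\<^sub>R Y) - mat 1) /\<^sub>R \<epsilon> n)
        + (matrix_exp (\<epsilon> n *\<^sub>R X) - mat 1) /\<^sub>R \<epsilon> n) \<longlonglongrightarrow> matrix_exp 0 ** Y + X"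
      by (intro tendsto_add matrix_mult.tendsto tendsto_matrix_exp null deriv)
    then have "(\<lambda>n. (h n - mat 1) /\<^sub>R \<epsilon> n) \<longlonglongrightarrow> X + Y"
      by (simp add: h_def matrix_mult.scaleR_right matrix_mult.diff_right add.commute
          flip: scaleR_add_right)
    moreover have "h n \<in> G" for n
      unfolding h_def using XY
      by (intro Lie_group_mult matrix_exp_Lie_algebra Lie_algebra_scaleR)
    ultimately show ?thesis using \<epsilon> by (intro tangent_vector_in_Lie_algebra)
  qed
qed

text \<open>This is where the Lie algebra is seen to exhaust all directions of \<open>G\<close> at the identity.
  Among counterexamples \<open>X n\<close> tending to \<open>0\<close>, the components \<open>W n\<close> orthogonal to the Lie
  algebra are nonzero, and their limiting direction is tangent to \<open>G\<close>: correcting \<open>exp (X n)\<close> by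
  \<open>exp (- Z n)\<close>, where \<open>Z n\<close> is the component inside the Lie algebra, leaves an element of \<open>G\<close>
  that differs from the identity by \<open>W n\<close> to first order.\<close>

lemma small_logarithm_in_Lie_algebra:
  "\<exists>\<delta>>0. \<forall>X. norm X < \<delta> \<longrightarrow> matrix_exp X \<in> G \<longrightarrow> X \<in> Lie_algebra G"
proof (rule ccontr)
  assume "\<not> ?thesis"
  then have "\<forall>n. \<exists>X. norm X < inverse (real (Suc n)) \<and> matrix_exp X \<in> G \<and> X \<notin> Lie_algebra G"
    by (metis inverse_positive_iff_positive of_nat_0_less_iff zero_less_Suc)
  then obtain X where X: "\<And>n. norm (X n) < inverse (real (Suc n))"
      "\<And>n. matrix_exp (X n) \<in> G" "\<And>n. X n \<notin> Lie_algebra G"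
    by metis
  have "\<exists>Z W. Z \<in> Lie_algebra G \<and> (\<forall>V\<in>Lie_algebra G. orthogonal W V) \<and> X n = Z + W" for n
    using orthogonal_subspace_decomp_exists[of "Lie_algebra G" "X n"] subspace_Lie_algebra
    by (metis span_eq_iff)
  then obtain Z W where Z: "\<And>n. Z n \<in> Lie_algebra G"
      and W: "\<And>n V. V \<in> Lie_algebra G \<Longrightarrow> orthogonal (W n) V"
      and XZW: "\<And>n. X n = Z n + W n"
    by metis
  have W_pos: "0 < norm (W n)" for n
    using X(3)[of n] Z[of n] XZW[of n] by auto
  have pyth: "(norm (X n))\<^sup>2 = (norm (Z n))\<^sup>2 + (norm (W n))\<^sup>2" for n
    unfolding XZW using W[OF Z] by (intro norm_add_Pythagorean) (simp add: orthogonal_commute)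
  have Z_le: "norm (Z n) \<le> norm (X n)" for n
    by (rule power2_le_imp_le) (simp_all add: pyth)
  have W_le: "norm (W n) \<le> norm (X n)" for n
    by (rule power2_le_imp_le) (simp_all add: pyth)
  have X0: "X \<longlonglongrightarrow> 0"
    by (rule Lim_null_comparison[OF _ LIMSEQ_inverse_real_of_nat])
      (intro always_eventually allI less_imp_le X(1))
  have Z0: "Z \<longlonglongrightarrow> 0"
    by (rule Lim_null_comparison[OF _ tendsto_norm_zero[OF X0]]) (simp add: Z_le)
  have W0: "W \<longlonglongrightarrow> 0"
    by (rule Lim_null_comparison[OF _ tendsto_norm_zero[OF X0]]) (simp add: W_le)
  have "\<forall>n. W n /\<^sub>R norm (W n) \<in> sphere 0 1" using W_pos by simp
  with compact_imp_seq_compact[OF compact_sphere] obtain Y r where Y: "Y \<in> sphere 0 1" "strict_mono (r :: nat \<Rightarrow> nat)"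
      and lim: "((\<lambda>n. W n /\<^sub>R norm (W n)) \<circ> r) \<longlonglongrightarrow> Y"
    by (rule seq_compactE)
  define h where "h n = matrix_exp (- Z (r n)) ** matrix_exp (X (r n))" for n
  have sub: "(\<lambda>n. X (r n)) \<longlonglongrightarrow> 0" "(\<lambda>n. Z (r n)) \<longlonglongrightarrow> 0" "(\<lambda>n. W (r n)) \<longlonglongrightarrow> 0"
    using X0 Z0 W0 LIMSEQ_subseq_LIMSEQ[OF _ Y(2)] by (auto simp: o_def)
  \<comment> \<open>\<open>h n - 1 = exp (- Z) (exp X - exp Z)\<close>, so the factor \<open>exp (- Z) \<rightarrow> 1\<close> does not affect
    the limit and the difference quotient lemma gives the direction of \<open>W = X - Z\<close>.\<close>
  have "(\<lambda>n. (matrix_exp (X (r n)) - matrix_exp (Z (r n))) /\<^sub>R norm (W (r n))) \<longlonglongrightarrow> Y"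
    using lim by (intro tendsto_matrix_exp_diff_quotient sub) (simp add: XZW o_def)
  moreover have "(\<lambda>n. matrix_exp (- Z (r n))) \<longlonglongrightarrow> mat 1"
    using tendsto_matrix_exp[OF tendsto_minus[OF sub(2)]] by simp
  ultimately have "(\<lambda>n. matrix_exp (- Z (r n)) **
      ((matrix_exp (X (r n)) - matrix_exp (Z (r n))) /\<^sub>R norm (W (r n)))) \<longlonglongrightarrow> mat 1 ** Y"
    by (intro matrix_mult.tendsto)
  then have "(\<lambda>n. (h n - mat 1) /\<^sub>R norm (W (r n))) \<longlonglongrightarrow> Y"
    by (simp add: h_def matrix_mult.scaleR_right matrix_mult.diff_right matrix_exp_minus)
  moreover have "h n \<in> G" for n
    unfolding h_def using Lie_algebra_scaleR[OF Z[of "r n"], of "-1"] X(2)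
    by (auto intro!: Lie_group_mult dest: matrix_exp_Lie_algebra)
  ultimately have "Y \<in> Lie_algebra G"
    using tangent_vector_in_Lie_algebra[of h "\<lambda>n. norm (W (r n))" Y] W_pos
      tendsto_norm_zero[OF sub(3)] by simp
  then have "W n \<bullet> Y = 0" for n
    using W[of Y n] by (simp add: orthogonal_def)
  then have "(\<lambda>n. 0 :: real) \<longlonglongrightarrow> Y \<bullet> Y"
    using tendsto_inner[OF lim tendsto_const[of Y]] by (simp add: o_def)
  then have "Y = 0" by (simp add: LIMSEQ_const_iff)
  then show False using Y(1) by simp
qed

end

section \<open>Exponential coordinates\<close>

theorem proposition1p10:
  fixes G :: "(real^'d^'d) set"
  assumes "matrix_Lie_group G"
  shows "\<exists>U V. openin (top_of_set (Lie_algebra G)) U \<and> 0 \<in> U \<and>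
               openin (top_of_set G) V \<and> mat 1 \<in> V \<and>
               bij_betw matrix_exp U V"
proof -
  obtain \<delta> where \<delta>: "0 < \<delta>"
      "\<And>X. norm X < \<delta> \<Longrightarrow> matrix_exp X \<in> G \<Longrightarrow> X \<in> Lie_algebra G"
    using small_logarithm_in_Lie_algebra[OF assms] by auto
  define r where "r = min \<delta> chart_radius"
  have r: "0 < r" "r \<le> \<delta>" "r \<le> chart_radius"
    using \<delta>(1) chart_radius_pos by (auto simp: r_def)
  define U where "U = Lie_algebra G \<inter> ball 0 r"
  define V where "V = G \<inter> matrix_exp ` ball 0 r"
  have "openin (top_of_set (Lie_algebra G)) U" "openin (top_of_set G) V"
    unfolding U_def V_def using open_matrix_exp_image[OF r(3)] by (auto simp: openin_open_Int)
  moreover have "0 \<in> U"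
    using r(1) subspace_0[OF subspace_Lie_algebra[OF assms]] by (simp add: U_def)
  moreover have "mat 1 \<in> V"
    using r(1) Lie_group_one[OF assms] by (auto simp: V_def intro!: image_eqI[of _ _ 0])
  moreover have "bij_betw matrix_exp U V"
  proof (rule bij_betw_imageI)
    show "inj_on matrix_exp U"
      by (rule inj_on_subset[OF inj_on_matrix_exp]) (use r(3) in \<open>auto simp: U_def\<close>)
    show "matrix_exp ` U = V"
      using \<delta>(2) r(2) matrix_exp_Lie_algebra[OF assms] by (fastforce simp: U_def V_def)
  qed
  ultimately show ?thesis by blast
qed

end
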